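(* Let $1<p\le 2$, $L,B>0$, $A\ge 0$, and let $F:\mathbb{R}^d\to\mathbb{R}$ be a convex differentiable function such that: (i) $F(s)\le 0$ for all $s\in\mathcal{S}$; (ii) $F(x+y)\le F(x)+\langle\nabla F(x),y\rangle+\frac{L}{2}\|y\|^2$ for all $x,y\in\mathbb{R}^d$; (iii) $(F(s)+A)^+\ge\inf_{s'\in\mathcal{S}}B\|s-s'\|^p$ for all $s\in\mathbb{R}^d$. Then for every sequence of losses $\ell_1,\dots,\ell_T\in\mathbb{R}^d$ and predictions $m_1,\dots,m_T\in\mathbb{R}^d$, optimistic Lagrangian hedging with potential $F$ and no step size (i.e. $\eta_t=1$ for all $t$) satisfies $$R^T_{\mathcal{X}}\le D\left(\frac{L\sum_{t=1}^T\|s_t-m_t\|^2+2A}{2B}\right)^{1/p}.$$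
   Context: $\mathcal{X}\subset\mathbb{R}^d$ is a nonempty convex compact set, and $u\in\mathbb{R}^d$ is a vector with $\langle u,x\rangle=1$ for all $x\in\mathcal{X}$. $\|\cdot\|$ is a norm on $\mathbb{R}^d$ with dual norm $\|x\|_*=\sup\{\langle x,y\rangle:\|y\|\le 1\}$, and $D$ is a constant with $\|x\|_*\le D$ for all $x\in\mathcal{X}$. The safe set is the polar cone $\mathcal{S}=\{s\in\mathbb{R}^d:\langle s,x\rangle\le 0\ \forall x\in\mathcal{X}\}$. For a real number $a$, $(a)^+=\max(a,0)$. Online linear optimization: in each round $t=1,\dots,T$ the algorithm selects $x_t\in\mathcal{X}$, and then a loss vector $\ell_t\in\mathbb{R}^d$ (arbitrary, possibly chosen adversarially after seeing $x_t$) is revealed. The regret is $R^T_{\mathcal{X}}=\sum_{t=1}^T\langle\ell_t,x_t\rangle-\min_{x\in\mathcal{X}}\sum_{t=1}^T\langle\ell_t,x\rangle$. Put $s_t=\langle\ell_t,x_t\rangle u-\ell_t$, $s_{1:0}=0$ and $s_{1:t}=\sum_{k=1}^t s_k$ (the regret vector). Optimistic Lagrangian hedging with step sizes $\eta_t$: in round $t$, a prediction $m_t\in\mathbb{R}^d$ is available before $x_t$ is chosen. Let $g_t=\nabla F(\eta_t(s_{1:t-1}+m_t))$. If $\langle g_t,u\rangle>0$ then $x_t=g_t/\langle g_t,u\rangle$; otherwise $x_t$ is an arbitrary element of $\mathcal{X}$. (Under the assumptions on $F$ this rule always gives $x_t\in\mathcal{X}$.) *)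

theory Defs
  imports "HOL-Analysis.Analysis"
begin

text \<open>An arbitrary norm on \<open>\<real>\<^sup>d\<close>; the library's \<open>norm\<close> on \<open>real ^ 'd\<close> is the Euclidean one.\<close>

definition is_norm :: "(real ^ 'd \<Rightarrow> real) \<Rightarrow> bool" where
  "is_norm N \<longleftrightarrow>
     (\<forall>x. 0 \<le> N x) \<and> (\<forall>x. N x = 0 \<longleftrightarrow> x = 0) \<and>
     (\<forall>a x. N (a *\<^sub>R x) = \<bar>a\<bar> * N x) \<and> (\<forall>x y. N (x + y) \<le> N x + N y)"

definition dual_norm :: "(real ^ 'd \<Rightarrow> real) \<Rightarrow> real ^ 'd \<Rightarrow> real" where
  "dual_norm N x = Sup {x \<bullet> y | y. N y \<le> 1}"

definition polar_cone :: "(real ^ 'd) set \<Rightarrow> (real ^ 'd) set" where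
  "polar_cone X = {s. \<forall>x\<in>X. s \<bullet> x \<le> 0}"

text \<open>Meaningful only where \<open>F\<close> is differentiable.\<close>

definition gradient :: "(real ^ 'd \<Rightarrow> real) \<Rightarrow> real ^ 'd \<Rightarrow> real ^ 'd" where
  "gradient F s = (THE g. GDERIV F s :> g)"

text \<open>The minimum over \<open>X\<close> is written as an infimum; it is attained when \<open>X\<close> is
  nonempty and compact.\<close>

definition regret ::
    "(real ^ 'd) set \<Rightarrow> nat \<Rightarrow> (nat \<Rightarrow> real ^ 'd) \<Rightarrow> (nat \<Rightarrow> real ^ 'd) \<Rightarrow> real" where
  "regret X T \<l> x =
     (\<Sum>t=1..T. \<l> t \<bullet> x t) - (INF y\<in>X. \<Sum>t=1..T. \<l> t \<bullet> y)"

definition regret_increment ::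
    "real ^ 'd \<Rightarrow> (nat \<Rightarrow> real ^ 'd) \<Rightarrow> (nat \<Rightarrow> real ^ 'd) \<Rightarrow> nat \<Rightarrow> real ^ 'd" where
  "regret_increment u \<l> x t = (\<l> t \<bullet> x t) *\<^sub>R u - \<l> t"

definition regret_vector ::
    "real ^ 'd \<Rightarrow> (nat \<Rightarrow> real ^ 'd) \<Rightarrow> (nat \<Rightarrow> real ^ 'd) \<Rightarrow> nat \<Rightarrow> real ^ 'd" where
  "regret_vector u \<l> x t = (\<Sum>k=1..t. regret_increment u \<l> x k)"

text \<open>The sequence \<open>x\<close> is a possible play, in rounds \<open>1, \<dots>, T\<close>, of optimistic Lagrangian
  hedging with potential \<open>F\<close> and step sizes \<open>\<eta>\<close> against the losses \<open>\<l>\<close> and the predictions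
  \<open>m\<close>. Since the algorithm may pick any point of \<open>X\<close> when \<open>g \<bullet> u \<le> 0\<close>, this is a relation
  rather than a function. The choice in round \<open>t\<close> refers only to losses of rounds before
  \<open>t\<close>, so quantifying over all \<open>\<l>\<close>, \<open>m\<close> and plays \<open>x\<close> covers adaptive adversaries.\<close>

definition optimistic_lagrangian_hedging ::
    "(real ^ 'd) set \<Rightarrow> real ^ 'd \<Rightarrow> (real ^ 'd \<Rightarrow> real) \<Rightarrow> (nat \<Rightarrow> real) \<Rightarrow> nat \<Rightarrow>
     (nat \<Rightarrow> real ^ 'd) \<Rightarrow> (nat \<Rightarrow> real ^ 'd) \<Rightarrow> (nat \<Rightarrow> real ^ 'd) \<Rightarrow> bool" where
  "optimistic_lagrangian_hedging X u F \<eta> T \<l> m x \<longleftrightarrow>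
     (\<forall>t\<in>{1..T}.
        let g = gradient F (\<eta> t *\<^sub>R (regret_vector u \<l> x (t - 1) + m t))
        in if g \<bullet> u > 0 then x t = (1 / (g \<bullet> u)) *\<^sub>R g else x t \<in> X)"

end

theory Submission
  imports Defs
begin

text \<open>
  The potential of the regret vector does not increase, up to the prediction errors:
  smoothness at the predicted point \<open>s\<^bsub>1:t-1\<^esub> + m\<^sub>t\<close> bounds \<open>F(s\<^bsub>1:t\<^esub>)\<close>, convexity
  returns from there to \<open>s\<^bsub>1:t-1\<^esub>\<close>, and the choice of \<open>x\<^sub>t\<close> makes \<open>s\<^sub>t\<close> orthogonal
  to the gradient. Hence \<open>F(s\<^bsub>1:T\<^esub>)\<close> is at most \<open>L/2\<close> times the sum of the squared errors,
  and the growth condition bounds the distance of \<open>s\<^bsub>1:T\<^esub>\<close> from the polar cone.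
  That distance, times \<open>D\<close>, dominates \<open>s\<^bsub>1:T\<^esub> \<bullet> y\<close> for every \<open>y \<in> X\<close>, and the supremum of
  these inner products is the regret.
\<close>

section \<open>Norms and dual norms\<close>

text \<open>A norm is convex, hence continuous in finite dimension, so it attains a positive minimum
  on the compact Euclidean unit sphere; homogeneity extends the bound to all vectors.\<close>

lemma is_norm_dominates_norm:
  fixes N :: "real ^ 'd \<Rightarrow> real"
  assumes "is_norm N"
  obtains c where "c > 0" "\<And>y. c * norm y \<le> N y"
proof -
  have N: "N 0 = 0" "\<And>y. N y \<ge> 0" "\<And>y. N y = 0 \<Longrightarrow> y = 0"
    "\<And>a y. N (a *\<^sub>R y) = \<bar>a\<bar> * N y" "\<And>y z. N (y + z) \<le> N y + N z"
    using assms by (auto simp: is_norm_def)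
  have "convex_on UNIV N"
  proof (rule convex_onI)
    fix t :: real and y z assume "0 < t" "t < 1"
    then show "N ((1 - t) *\<^sub>R y + t *\<^sub>R z) \<le> (1 - t) * N y + t * N z"
      using N(5)[of "(1 - t) *\<^sub>R y" "t *\<^sub>R z"] by (simp add: N(4))
  qed simp
  then have "continuous_on (sphere 0 1) N"
    using convex_on_continuous[of UNIV N] continuous_on_subset by blast
  moreover have "sphere (0 :: real ^ 'd) 1 \<noteq> {}"
    by simp
  ultimately obtain e where e: "norm e = 1" "\<And>y. norm y = 1 \<Longrightarrow> N e \<le> N y"
    using continuous_attains_inf[of "sphere 0 1" N] by auto
  show thesis
  proof
    show "N e > 0"
      using e(1) N(2,3)[of e] by (cases "N e = 0") (auto simp: less_le)
    show "N e * norm y \<le> N y" for y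
    proof (cases "y = 0")
      case False
      then have "N e \<le> N ((1 / norm y) *\<^sub>R y)"
        by (intro e(2)) simp
      with False show ?thesis
        by (simp add: N(4) field_simps)
    qed (simp add: N(1))
  qed
qed

text \<open>This makes the \<open>Sup\<close> in \<open>dual_norm\<close> a genuine least upper
  bound rather than an unspecified value.\<close>

lemma bdd_above_dual_norm:
  fixes N :: "real ^ 'd \<Rightarrow> real"
  assumes "is_norm N"
  shows "bdd_above {x \<bullet> y | y. N y \<le> 1}"
proof -
  obtain c where c: "c > 0" "\<And>y. c * norm y \<le> N y"
    using is_norm_dominates_norm[OF assms] by blast
  show ?thesis
  proof (rule bdd_aboveI, clarify)
    fix y assume "N y \<le> 1"
    with c(2)[of y] c(1) have "norm y \<le> 1 / c"
      by (simp add: field_simps)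
    then show "x \<bullet> y \<le> norm x * (1 / c)"
      by (meson norm_cauchy_schwarz mult_left_mono norm_ge_zero order_trans)
  qed
qed

lemma inner_le_dual_norm:
  fixes N :: "real ^ 'd \<Rightarrow> real"
  assumes "is_norm N"
  shows "x \<bullet> y \<le> dual_norm N x * N y"
proof (cases "y = 0")
  case True
  moreover have "N 0 = 0" using assms by (simp add: is_norm_def)
  ultimately show ?thesis by simp
next
  case False
  then have pos: "N y > 0" using assms by (simp add: is_norm_def less_le)
  have "N ((1 / N y) *\<^sub>R y) = \<bar>1 / N y\<bar> * N y"
    using assms unfolding is_norm_def by blast
  with pos have "N ((1 / N y) *\<^sub>R y) \<le> 1" by simp
  then have "x \<bullet> ((1 / N y) *\<^sub>R y) \<le> dual_norm N x"
    unfolding dual_norm_def by (intro cSup_upper bdd_above_dual_norm assms) blast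
  with pos show ?thesis by (simp add: field_simps)
qed

lemma dual_norm_nonneg:
  fixes N :: "real ^ 'd \<Rightarrow> real"
  assumes "is_norm N"
  shows "dual_norm N x \<ge> 0"
proof -
  have "N 0 = 0" using assms by (simp add: is_norm_def)
  then have "x \<bullet> 0 \<le> dual_norm N x"
    unfolding dual_norm_def
    by (intro cSup_upper bdd_above_dual_norm assms CollectI exI[of _ 0]) simp
  then show ?thesis by simp
qed

section \<open>Gradients of convex functions\<close>

lemma GDERIV_gradient:
  fixes F :: "real ^ 'd \<Rightarrow> real"
  assumes "F differentiable (at s)"
  shows "GDERIV F s :> gradient F s"
proof -
  obtain F' where F': "(F has_derivative F') (at s)"
    using assms by (auto simp: differentiable_def)
  \<comment> \<open>Riesz representation: the adjoint of a linear functional, applied to 1, is the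
    vector representing it.\<close>
  have "F' = (\<lambda>h. h \<bullet> adjoint F' 1)"
    by (simp add: fun_eq_iff adjoint_works[OF has_derivative_linear[OF F']])
  then have "GDERIV F s :> adjoint F' 1"
    using F' by (simp only: gderiv_def)
  moreover have "g = g'" if "GDERIV F s :> g" "GDERIV F s :> g'" for g g'
  proof -
    have "(\<lambda>h. h \<bullet> g) = (\<lambda>h. h \<bullet> g')"
      using that has_derivative_unique unfolding gderiv_def by blast
    then show ?thesis by (metis inner_commute vector_eq_rdot)
  qed
  ultimately have "\<exists>!g. GDERIV F s :> g" by blast
  then show ?thesis unfolding gradient_def by (rule theI')
qed

text \<open>Restricting \<open>F\<close> to the line through \<open>y\<close> and \<open>z\<close>
  reduces this to the tangent inequality in one variable.\<close>

lemma convex_on_above_gradient: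
  fixes F :: "real ^ 'd \<Rightarrow> real"
  assumes "convex_on UNIV F" "F differentiable (at y)"
  shows "F y + gradient F y \<bullet> (z - y) \<le> F z"
proof -
  define h where "h = (\<lambda>t. F (y + t *\<^sub>R (z - y)))"
  have "convex_on UNIV h"
  proof (rule convex_onI)
    fix t a b :: real assume "0 < t" "t < 1"
    moreover have "y + ((1 - t) *\<^sub>R a + t *\<^sub>R b) *\<^sub>R (z - y)
        = (1 - t) *\<^sub>R (y + a *\<^sub>R (z - y)) + t *\<^sub>R (y + b *\<^sub>R (z - y))"
      by (simp add: algebra_simps)
    ultimately show "h ((1 - t) *\<^sub>R a + t *\<^sub>R b) \<le> (1 - t) * h a + t * h b"
      unfolding h_def using convex_onD[OF assms(1), of t] by simp
  qed simp
  moreover have "(h has_field_derivative gradient F y \<bullet> (z - y)) (at 0)"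
  proof -
    have "(F has_derivative (\<lambda>v. v \<bullet> gradient F y)) (at (y + 0 *\<^sub>R (z - y)))"
      using GDERIV_gradient[OF assms(2)] by (simp add: gderiv_def)
    moreover have "((\<lambda>t. y + t *\<^sub>R (z - y)) has_derivative (\<lambda>t. t *\<^sub>R (z - y))) (at 0)"
      by (auto intro!: derivative_eq_intros)
    ultimately have "(h has_derivative (\<lambda>t. (t *\<^sub>R (z - y)) \<bullet> gradient F y)) (at 0)"
      unfolding h_def by (rule has_derivative_compose[rotated])
    moreover have "(\<lambda>t. (t *\<^sub>R (z - y)) \<bullet> gradient F y) = (*) (gradient F y \<bullet> (z - y))"
      by (simp add: fun_eq_iff inner_commute[of "z - y"])
    ultimately show ?thesis
      by (simp add: has_field_derivative_def)
  qed
  ultimately have "gradient F y \<bullet> (z - y) * (1 - 0) \<le> h 1 - h 0"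
    by (intro convex_on_imp_above_tangent[where A = UNIV]) auto
  then show ?thesis by (simp add: h_def)
qed

section \<open>Gradients against the polar cone\<close>

text \<open>Otherwise the tangent bound at \<open>y\<close> would grow without limit along the ray
  through \<open>s\<close>, which stays in the cone, where \<open>F\<close> is nonpositive.\<close>

lemma gradient_inner_polar_cone_nonpos:
  fixes F :: "real ^ 'd \<Rightarrow> real"
  assumes "convex_on UNIV F" "F differentiable (at y)"
    and "\<forall>s\<in>polar_cone X. F s \<le> 0" and "s \<in> polar_cone X"
  shows "gradient F y \<bullet> s \<le> 0"
proof (rule ccontr)
  assume "\<not> ?thesis"
  then have pos: "gradient F y \<bullet> s > 0" by simp
  \<comment> \<open>Beyond this threshold the tangent at \<open>y\<close> takes a positive value at
    \<open>real n *\<^sub>R s\<close>.\<close>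
  obtain n :: nat where n: "(gradient F y \<bullet> y - F y) / (gradient F y \<bullet> s) < n"
    using reals_Archimedean2 by blast
  have "real n *\<^sub>R s \<in> polar_cone X"
    using assms(4) by (auto simp: polar_cone_def mult_nonneg_nonpos)
  then have "F y + gradient F y \<bullet> (real n *\<^sub>R s - y) \<le> 0"
    using convex_on_above_gradient[OF assms(1,2)] assms(3) order_trans by blast
  with n pos show False by (simp add: field_simps inner_diff_right)
qed

text \<open>Since \<open>-u\<close> is an interior point of the polar cone, a small multiple of \<open>g\<close> can be added to it
  without leaving the cone.\<close>

lemma zero_if_inner_polar_cone_nonpos:
  fixes g u :: "real ^ 'd"
  assumes "compact X" "\<forall>y\<in>X. u \<bullet> y = 1"
    and nonpos: "\<And>s. s \<in> polar_cone X \<Longrightarrow> g \<bullet> s \<le> 0" and "g \<bullet> u \<le> 0"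
  shows "g = 0"
proof -
  obtain K where K: "K > 0" "\<And>y. y \<in> X \<Longrightarrow> norm y \<le> K"
    using assms(1) compact_imp_bounded bounded_pos by metis
  \<comment> \<open>Chosen so that \<open>e * (g \<bullet> y) \<le> 1 = u \<bullet> y\<close> on
    \<open>X\<close>; the added 1 keeps the denominator positive even when
    \<open>g = 0\<close>.\<close>
  define e where "e = 1 / (K * (norm g + 1))"
  have pos: "K * (norm g + 1) > 0"
    using K(1) norm_ge_zero[of g] by (intro mult_pos_pos) linarith+
  then have e: "e > 0" by (simp add: e_def)
  have "- u + e *\<^sub>R g \<in> polar_cone X"
    unfolding polar_cone_def
  proof clarify
    fix y assume y: "y \<in> X"
    have "g \<bullet> y \<le> norm g * norm y" by (rule norm_cauchy_schwarz)
    also have "\<dots> \<le> (norm g + 1) * K"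
      using K y by (intro mult_mono) auto
    finally have "e * (g \<bullet> y) \<le> e * ((norm g + 1) * K)"
      using e by simp
    also have "\<dots> = 1"
      using pos unfolding e_def mult.commute[of "norm g + 1"]
      by (metis less_irrefl nonzero_eq_divide_eq)
    finally show "(- u + e *\<^sub>R g) \<bullet> y \<le> 0"
      using assms(2) y by (simp add: inner_diff_left)
  qed
  then have "e * (g \<bullet> g) \<le> g \<bullet> u"
    using nonpos[of "- u + e *\<^sub>R g"] by (simp add: inner_diff_right)
  with e assms(4) have "g \<bullet> g \<le> 0"
    by (smt (verit) mult_pos_pos)
  then show ?thesis by (metis inner_gt_zero_iff not_less)
qed

section \<open>The regret vector and its potential\<close>

lemma regret_vector_eq:
  assumes "t \<ge> 1"
  shows "regret_vector u l x t = regret_vector u l x (t - 1) + regret_increment u l x t"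
  using assms by (cases t) (simp_all add: regret_vector_def)

lemma regret_vector_inner:
  assumes "u \<bullet> y = 1"
  shows "regret_vector u l x T \<bullet> y = (\<Sum>t=1..T. l t \<bullet> x t) - (\<Sum>t=1..T. l t \<bullet> y)"
  using assms
  by (simp add: regret_vector_def regret_increment_def inner_sum_left inner_diff_left sum_subtractf)

text \<open>For \<open>x t = g / (g \<bullet> u)\<close>, both terms of
  \<open>g \<bullet> regret_increment u l x t\<close> equal \<open>g \<bullet> l t\<close> and
  cancel. When \<open>x t\<close> is arbitrary, \<open>g\<close> itself vanishes.\<close>

lemma gradient_orthogonal_regret_increment:
  fixes F :: "real ^ 'd \<Rightarrow> real"
  assumes "compact X" "\<forall>y\<in>X. u \<bullet> y = 1"
    and "convex_on UNIV F" "\<forall>s. F differentiable (at s)" "\<forall>s\<in>polar_cone X. F s \<le> 0"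
    and "optimistic_lagrangian_hedging X u F \<eta> T l m x" "t \<in> {1..T}"
  shows "gradient F (\<eta> t *\<^sub>R (regret_vector u l x (t - 1) + m t)) \<bullet> regret_increment u l x t = 0"
proof -
  define g where "g = gradient F (\<eta> t *\<^sub>R (regret_vector u l x (t - 1) + m t))"
  have "g \<bullet> regret_increment u l x t = 0"
  proof (cases "g \<bullet> u > 0")
    case True
    with assms(6,7) have "x t = (1 / (g \<bullet> u)) *\<^sub>R g"
      by (simp add: optimistic_lagrangian_hedging_def g_def Let_def)
    with True show ?thesis
      by (simp add: regret_increment_def inner_diff_right inner_commute)
  next
    case False
    then have "g = 0"
      using zero_if_inner_polar_cone_nonpos[OF assms(1,2)]
        gradient_inner_polar_cone_nonpos[OF assms(3) _ assms(5)] assms(4)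
      by (simp add: g_def)
    then show ?thesis by simp
  qed
  then show ?thesis by (simp add: g_def)
qed

lemma potential_regret_vector_le:
  fixes F :: "real ^ 'd \<Rightarrow> real"
  assumes "compact X" "\<forall>y\<in>X. u \<bullet> y = 1"
    and "convex_on UNIV F" "\<forall>s. F differentiable (at s)" "\<forall>s\<in>polar_cone X. F s \<le> 0"
    and smooth: "\<forall>y z. F (y + z) \<le> F y + gradient F y \<bullet> z + L / 2 * (N z)\<^sup>2"
    and "optimistic_lagrangian_hedging X u F (\<lambda>t. 1) T l m x" "t \<le> T"
  shows "F (regret_vector u l x t) \<le> L / 2 * (\<Sum>k=1..t. (N (regret_increment u l x k - m k))\<^sup>2)"
  using \<open>t \<le> T\<close>
proof (induction t)
  case 0
  have "(0 :: real ^ 'd) \<in> polar_cone X" by (simp add: polar_cone_def)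
  then show ?case using assms(5) by (simp add: regret_vector_def)
next
  case (Suc t)
  define r where "r = regret_vector u l x t"
  define s where "s = regret_increment u l x (Suc t)"
  define q where "q = m (Suc t)"
  define g where "g = gradient F (r + q)"
  have "g \<bullet> s = 0"
    using gradient_orthogonal_regret_increment[OF assms(1-5,7), of "Suc t"] Suc.prems
    by (simp add: g_def r_def s_def q_def)
  moreover have "F (r + q) - g \<bullet> q \<le> F r"
    using convex_on_above_gradient[OF assms(3), of "r + q" r] assms(4) by (simp add: g_def)
  \<comment> \<open>As \<open>g \<bullet> s = 0\<close>, the first-order term is
    \<open>- (g \<bullet> q)\<close>, which the convexity bound absorbs into \<open>F r\<close>;
    only the quadratic error remains.\<close>
  moreover have "F (r + s) \<le> F (r + q) + g \<bullet> (s - q) + L / 2 * (N (s - q))\<^sup>2"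
    using smooth[rule_format, of "r + q" "s - q"] by (simp add: g_def)
  moreover have "F r \<le> L / 2 * (\<Sum>k=1..t. (N (regret_increment u l x k - m k))\<^sup>2)"
    using Suc by (simp add: r_def)
  moreover have "regret_vector u l x (Suc t) = r + s"
    using regret_vector_eq[of "Suc t"] by (simp add: r_def s_def)
  ultimately show ?case
    by (simp add: inner_diff_right s_def q_def distrib_left)
qed

section \<open>From distance to the cone to regret\<close>

text \<open>Subtracting a point \<open>s'\<close> of the cone can only increase the inner product
  with \<open>y\<close>, so duality of the norms bounds \<open>s \<bullet> y\<close> by
  \<open>D * N (s - s')\<close> for every such \<open>s'\<close>.\<close>

lemma inner_le_of_polar_cone_distance:
  fixes N :: "real ^ 'd \<Rightarrow> real"
  assumes "is_norm N" "dual_norm N y \<le> D" "y \<in> X" "p > 0" "B > 0" "Q \<ge> 0"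
    and "(INF s'\<in>polar_cone X. B * N (s - s') powr p) \<le> Q"
  shows "s \<bullet> y \<le> D * (Q / B) powr (1 / p)"
proof (cases "s \<bullet> y \<le> 0")
  case True
  have "D \<ge> 0" using dual_norm_nonneg[OF assms(1)] assms(2) order_trans by blast
  with True show ?thesis by (smt (verit) mult_nonneg_nonneg powr_ge_zero)
next
  case False
  have Npos: "N z \<ge> 0" for z using assms(1) by (simp add: is_norm_def)
  have dist: "s \<bullet> y \<le> D * N (s - s')" if "s' \<in> polar_cone X" for s'
  proof -
    have "s' \<bullet> y \<le> 0" using that assms(3) by (simp add: polar_cone_def)
    then have "s \<bullet> y \<le> y \<bullet> (s - s')" by (simp add: inner_diff_right inner_commute)
    also have "\<dots> \<le> dual_norm N y * N (s - s')" by (rule inner_le_dual_norm[OF assms(1)])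
    also have "\<dots> \<le> D * N (s - s')" using assms(2) Npos by (rule mult_right_mono)
    finally show ?thesis .
  qed
  have zero: "0 \<in> polar_cone X" by (simp add: polar_cone_def)
  \<comment> \<open>Taking \<open>s' = 0\<close> in a positive inner product forces \<open>D\<close>
    to be positive, which permits division by it.\<close>
  have D: "D > 0"
    using dist[OF zero] False Npos[of "s - 0"] by (smt (verit) mult_nonpos_nonneg)
  \<comment> \<open>The bound is uniform in \<open>s'\<close>, so it passes to the infimum without
    choosing a nearest point.\<close>
  have "B * (s \<bullet> y / D) powr p \<le> (INF s'\<in>polar_cone X. B * N (s - s') powr p)"
  proof (rule cINF_greatest)
    fix s' assume "s' \<in> polar_cone X"
    then have "s \<bullet> y / D \<le> N (s - s')" using dist D by (simp add: field_simps)
    then show "B * (s \<bullet> y / D) powr p \<le> B * N (s - s') powr p"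
      using False D assms(4,5) by (intro mult_left_mono powr_mono2) auto
  qed (use zero in auto)
  with assms(7) have "(s \<bullet> y / D) powr p \<le> Q / B"
    using assms(5) by (simp add: field_simps)
  then have "((s \<bullet> y / D) powr p) powr (1 / p) \<le> (Q / B) powr (1 / p)"
    using assms(4) by (intro powr_mono2) auto
  then have "s \<bullet> y / D \<le> (Q / B) powr (1 / p)"
    using False D assms(4) by (simp add: powr_powr)
  then show ?thesis using D by (simp add: field_simps)
qed

theorem mainTheorem2:
  fixes X :: "(real ^ 'd) set" and u :: "real ^ 'd"
    and N :: "real ^ 'd \<Rightarrow> real" and F :: "real ^ 'd \<Rightarrow> real"
    and D p L B A :: real
    and T :: nat and \<l> m x :: "nat \<Rightarrow> real ^ 'd"
  assumes "X \<noteq> {}" and "convex X" and "compact X"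
    and "\<forall>y\<in>X. u \<bullet> y = 1"
    and "is_norm N"
    and "\<forall>y\<in>X. dual_norm N y \<le> D"
    and "1 < p" and "p \<le> 2" and "L > 0" and "B > 0" and "A \<ge> 0"
    and "convex_on UNIV F"
    and "\<forall>s. F differentiable (at s)"
    and "\<forall>s\<in>polar_cone X. F s \<le> 0"
    and "\<forall>y z. F (y + z) \<le> F y + gradient F y \<bullet> z + L / 2 * (N z)\<^sup>2"
    and "\<forall>s. max (F s + A) 0 \<ge> (INF s'\<in>polar_cone X. B * N (s - s') powr p)"
    and "optimistic_lagrangian_hedging X u F (\<lambda>t. 1) T \<l> m x"
  shows "regret X T \<l> x \<le>
    D * ((L * (\<Sum>t=1..T. (N (regret_increment u \<l> x t - m t))\<^sup>2) + 2 * A) / (2 * B)) powr (1 / p)"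
proof -
  define E where "E = (\<Sum>t=1..T. (N (regret_increment u \<l> x t - m t))\<^sup>2)"
  define s where "s = regret_vector u \<l> x T"
  \<comment> \<open>Nonnegativity lets the bound on \<open>F s + A\<close> survive taking the
    positive part.\<close>
  have Q: "0 \<le> L / 2 * E + A"
    using \<open>L > 0\<close> \<open>A \<ge> 0\<close> by (simp add: E_def sum_nonneg)
  have "F s \<le> L / 2 * E"
    unfolding s_def E_def
    using potential_regret_vector_le[OF assms(3,4,12-15,17) order.refl] .
  then have "max (F s + A) 0 \<le> L / 2 * E + A"
    using Q by simp
  then have INF: "(INF s'\<in>polar_cone X. B * N (s - s') powr p) \<le> L / 2 * E + A"
    using assms(16) order_trans by blast
  define R where "R = D * ((L * E + 2 * A) / (2 * B)) powr (1 / p)"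
  have "(L / 2 * E + A) / B = (L * E + 2 * A) / (2 * B)"
    using \<open>B > 0\<close> by (simp add: field_simps)
  then have inner_le: "s \<bullet> y \<le> R" if "y \<in> X" for y
    using inner_le_of_polar_cone_distance[OF assms(5) _ that _ \<open>B > 0\<close> Q INF, of D]
      assms(6) that \<open>1 < p\<close> by (simp add: R_def)
  \<comment> \<open>\<open>R\<close> bounds the regret against each fixed \<open>y\<close>, so the
    comparison passes to the best \<open>y\<close> in hindsight.\<close>
  have "(\<Sum>t=1..T. \<l> t \<bullet> x t) - R \<le> (INF y\<in>X. \<Sum>t=1..T. \<l> t \<bullet> y)"
  proof (rule cINF_greatest[OF \<open>X \<noteq> {}\<close>])
    fix y assume "y \<in> X"
    then show "(\<Sum>t=1..T. \<l> t \<bullet> x t) - R \<le> (\<Sum>t=1..T. \<l> t \<bullet> y)"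
      using inner_le[of y] regret_vector_inner[of u y \<l> x T] assms(4) by (simp add: s_def)
  qed
  then show ?thesis
    by (simp add: regret_def R_def E_def)
qed

end
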